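(* Let $q$ be an arbitrary prime power and let $n = \ell N$ be a sum-rank length partition with equal sublengths $N = n_1 = \cdots = n_\ell$ (extension degree $m=1$). Let $r \geq N$ be such that $N$ divides $r$, $r = hN$. Let $\mathcal{C}_{out} \subseteq \mathbb{F}_q^n$ be a proper sum-rank Hamming code with redundancy $r = n - \dim(\mathcal{C}_{out})$, and for $i=1,\ldots,\ell$ let the $i$th local code $\mathcal{C}_i \subseteq \mathbb{F}_q^{N+1}$ have generator matrix $$ A_i = \begin{pmatrix} 1 & 0 & \cdots & 0 & 1 \\ 0 & 1 & \cdots & 0 & 1 \\ \vdots & \vdots & \ddots & \vdots & \vdots \\ 0 & 0 & \cdots & 1 & 1 \end{pmatrix} \in \mathbb{F}_q^{N \times (N+1)}. $$ Then the global code $\mathcal{C}_{glob} = \mathcal{C}_{out}\, \mathrm{diag}(A_1, A_2, \ldots, A_\ell)$ has locality $N$ and number of local groups, total length and dimension given by $$ \ell = \frac{q^r-1}{q^N-1}, \quad M = (N+1)\frac{q^r-1}{q^N-1} \quad\text{and}\quad k = N\frac{q^r-1}{q^N-1} - r = N\left( \frac{q^r-1}{q^N-1} - h \right), $$ respectively. Therefore, the number of local parities is $1$ per local group (i.e., the redundancy of each local code) and the number of global parities is $r$ (i.e., the redundancy of the outer code). Finally, $\mathcal{C}_{glob}$ may correct one erasure locally by a simple XOR of the remaining nodes in that local group (i.e., the erased symbol is a sum, with coefficients $\pm 1$, of the remaining $N$ symbols of its local group), and it may correct any erasure pattern with one erasure per local group plus any other $2$ extra erasures anywhere.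
   Context: Sum-rank metric for $m=1$: for $\mathbf{c} = (\mathbf{c}^{(1)}, \ldots, \mathbf{c}^{(\ell)}) \in \mathbb{F}_q^n$ with $\mathbf{c}^{(i)} \in \mathbb{F}_q^{N}$, the sum-rank weight is $\mathrm{wt}_{SR}(\mathbf{c}) = \sum_{i=1}^\ell \mathrm{Rk}(\mathbf{c}^{(i)})$, where $\mathbf{c}^{(i)}$ is viewed as a $1\times N$ matrix over $\mathbb{F}_q$ (so the weight is the number of nonzero blocks). For a linear code (subspace) $\mathcal{C}$, $\mathrm{d}_{SR}(\mathcal{C}) = \min\{\mathrm{wt}_{SR}(\mathbf{c}) \mid \mathbf{c} \in \mathcal{C}\setminus\{\mathbf{0}\}\}$. Proper sum-rank Hamming code ($m=1$): a linear code $\mathcal{C} \subseteq \mathbb{F}_q^n$, $n = \ell N$, of redundancy $r = n - \dim(\mathcal{C})$, such that $\mathrm{d}_{SR}(\mathcal{C}) \geq 3$ and there is no linear code $\mathcal{C}' \subseteq \mathbb{F}_q^{n'}$ with $\mathrm{d}_{SR}(\mathcal{C}') \geq 3$ and $n' - \dim(\mathcal{C}') = r$ for a partition $n' = \ell' N$ into $\ell'$ blocks of the same length $N$ with $\ell' > \ell$. $\mathrm{diag}(A_1,\ldots,A_\ell)\in\mathbb{F}_q^{n\times M}$ is the block-diagonal matrix, with $M = \ell(N+1)$, and $\mathcal{C}_{out}\,\mathrm{diag}(A_1,\ldots,A_\ell) = \{\mathbf{c}\,\mathrm{diag}(A_1,\ldots,A_\ell) \mid \mathbf{c}\in\mathcal{C}_{out}\}\subseteq\mathbb{F}_q^M$.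 The $i$th local group $\Gamma_i\subseteq\{1,\ldots,M\}$ is the set of coordinates from $(i-1)(N+1)+1$ to $i(N+1)$. Locality $N$ means that any single erased coordinate of a codeword of $\mathcal{C}_{glob}$ can be recovered from the other $N$ coordinates of its local group. An erasure pattern $\mathcal{E}\subseteq\{1,\ldots,M\}$ can be corrected by $\mathcal{C}_{glob}$ if every codeword is uniquely determined by its coordinates outside $\mathcal{E}$. *)

theory Defs
  imports
    "Jordan_Normal_Form.DL_Rank"
    "HOL-Library.Cardinality"
    "HOL-Library.Extended_Nat"
begin

text \<open>Coordinates, blocks and local groups are indexed from 0. Row vectors are represented by
  the type of vectors, so the product of a row vector \<open>c\<close> with a matrix \<open>G\<close> is \<open>G\<^sup>T *\<^sub>v c\<close>.\<close>

definition linear_code :: "nat \<Rightarrow> 'a::field vec set \<Rightarrow> bool" where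
  "linear_code n C \<longleftrightarrow> VectorSpace.subspace class_ring C (module_vec TYPE('a) n)"

definition code_dim :: "nat \<Rightarrow> 'a::field vec set \<Rightarrow> nat" where
  "code_dim n C = vectorspace.dim class_ring ((module_vec TYPE('a) n)\<lparr>carrier := C\<rparr>)"

definition redundancy :: "nat \<Rightarrow> 'a::field vec set \<Rightarrow> nat" where
  "redundancy n C = n - code_dim n C"

definition block :: "nat \<Rightarrow> 'a vec \<Rightarrow> nat \<Rightarrow> 'a vec" where
  "block N c i = vec N (\<lambda>j. c $ (i * N + j))"

definition wt_SR :: "nat \<Rightarrow> nat \<Rightarrow> 'a::field vec \<Rightarrow> nat" where
  "wt_SR l N c = (\<Sum>i<l. vec_space.rank 1 (mat_of_rows N [block N c i]))"

text \<open>The minimum of the empty set is infinite, so the zero code has infinite minimum distance.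
  This covers the case of redundancy \<open>N\<close>, where the only proper Hamming code is
  the zero code of length \<open>N\<close>.\<close>

definition d_SR :: "nat \<Rightarrow> nat \<Rightarrow> 'a::field vec set \<Rightarrow> enat" where
  "d_SR l N C = (INF c \<in> C - {0\<^sub>v (l * N)}. enat (wt_SR l N c))"

definition proper_SR_Hamming :: "nat \<Rightarrow> nat \<Rightarrow> 'a::field vec set \<Rightarrow> bool" where
  "proper_SR_Hamming l N C \<longleftrightarrow>
     linear_code (l * N) C \<and> d_SR l N C \<ge> 3 \<and>
     \<not> (\<exists>l' (C' :: 'a vec set). l' > l \<and> linear_code (l' * N) C' \<and> d_SR l' N C' \<ge> 3 \<and>
          redundancy (l' * N) C' = redundancy (l * N) C)"

definition local_generator :: "nat \<Rightarrow> 'a::field mat" where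
  "local_generator N = mat N (N + 1) (\<lambda>(i, j). if j = i \<or> j = N then 1 else 0)"

definition code_times_mat :: "'a::field vec set \<Rightarrow> 'a mat \<Rightarrow> 'a vec set" where
  "code_times_mat C G = {G\<^sup>T *\<^sub>v c | c. c \<in> C}"

definition local_group :: "nat \<Rightarrow> nat \<Rightarrow> nat set" where
  "local_group N i = {i * (N + 1)..<(i + 1) * (N + 1)}"

definition recoverable_from :: "'a vec set \<Rightarrow> nat \<Rightarrow> nat set \<Rightarrow> bool" where
  "recoverable_from C j S \<longleftrightarrow> (\<exists>f. \<forall>c\<in>C. c $ j = f (restrict (\<lambda>t. c $ t) S))"

definition has_locality :: "nat \<Rightarrow> nat \<Rightarrow> 'a vec set \<Rightarrow> bool" where
  "has_locality l N C \<longleftrightarrow>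
     (\<forall>i<l. \<forall>j\<in>local_group N i. recoverable_from C j (local_group N i - {j}))"

definition corrects :: "nat \<Rightarrow> 'a vec set \<Rightarrow> nat set \<Rightarrow> bool" where
  "corrects M C E \<longleftrightarrow>
     (\<forall>c\<in>C. \<forall>d\<in>C. (\<forall>t\<in>{..<M} - E. c $ t = d $ t) \<longrightarrow> c = d)"

end

theory Submission
  imports Defs "HOL-Algebra.Algebraic_Closure_Type"
begin

text \<open>The length is determined by two bounds. Since \<open>d \<ge> 3\<close>, the translates of the outer code by
  the \<open>1 + l (q\<^sup>N - 1)\<close> words of weight at most 1 are disjoint, so this number is at most \<open>q\<^sup>r\<close>.
  Conversely, as \<open>N\<close> divides \<open>r\<close>, the field with \<open>q\<^sup>r\<close> elements is a vector space over its subfield with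
  \<open>q\<^sup>N\<close> elements, and its lines form a spread. Bases of these lines over the field with \<open>q\<close> elements
  are the columns of the parity check matrix of a code of the same redundancy with
  \<open>(q\<^sup>r - 1) / (q\<^sup>N - 1)\<close> blocks, so a proper code cannot have fewer.

  Each local code is a single parity check code. Hence two codewords which differ in a local group
  differ there in at least two positions, so one erasure per group and two more erasures can hide
  a difference in at most two blocks of the outer code.\<close>

no_notation fps_nth (infixl "$" 75)

section \<open>Finite subfields of the algebraic closure\<close>

lemma two_le_CARD: "2 \<le> CARD('a::{field,finite})"
  using card_mono[of UNIV "{0, 1 :: 'a}"] by simp

text \<open>Multiplication by a nonzero \<open>x\<close> permutes the nonzero elements, so their
  product absorbs all the factors \<open>x\<close>. Carrying one further factor \<open>x\<close>
  along gives the power \<open>q\<close> directly.\<close>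

lemma field_power_card:
  fixes x :: "'a::{field,finite}"
  shows "x ^ CARD('a) = x"
proof (cases "x = 0")
  case False
  have card_Suc: "Suc (CARD('a) - 1) = CARD('a)"
    using finite_UNIV_card_ge_0[where ?'a = 'a] by simp
  have "x * (\<Prod>y\<in>UNIV - {0}. x * y) = x * x ^ (CARD('a) - 1) * \<Prod>(UNIV - {0})"
    by (simp add: prod.distrib mult_ac)
  also have "x * x ^ (CARD('a) - 1) = x ^ CARD('a)"
    by (metis card_Suc power_Suc)
  also have "(\<Prod>y\<in>UNIV - {0}. x * y) = (\<Prod>y\<in>UNIV - {0}. y)"
    by (rule prod.reindex_bij_witness[of _ "\<lambda>y. y / x" "\<lambda>y. x * y"]) (use False in auto)
  finally show ?thesis
    by simp
qed (use finite_UNIV_card_ge_0[where ?'a = 'a] in auto)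

text \<open>The polynomial \<open>(X + 1)\<^sup>q - X\<^sup>q - 1\<close> has degree less than \<open>q\<close> and vanishes on the whole field.\<close>

lemma of_nat_card_choose:
  assumes "0 < k" "k < CARD('a)"
  shows "of_nat (CARD('a) choose k) = (0 :: 'a::{field,finite})"
proof -
  let ?q = "CARD('a)"
  define p :: "'a poly" where "p = (\<Sum>k\<in>{0<..<?q}. Polynomial.monom (of_nat (?q choose k)) k)"
  have "poly p x = 0" for x
  proof -
    have "x + 1 = (x + 1) ^ ?q"
      by (simp add: field_power_card)
    also have "\<dots> = (\<Sum>k\<le>?q. of_nat (?q choose k) * x ^ k)"
      by (simp add: binomial_ring)
    also have "{..?q} = insert 0 (insert ?q {0<..<?q})"
      by auto
    also have "(\<Sum>k\<in>\<dots>. of_nat (?q choose k) * x ^ k) = 1 + (x ^ ?q + poly p x)"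
      using assms by (simp add: p_def poly_sum poly_monom)
    finally show ?thesis
      by (simp add: field_power_card)
  qed
  moreover have "Polynomial.degree p < ?q"
    unfolding p_def
    by (intro le_less_trans[OF degree_sum_le[of _ _ "?q - 1"]])
      (use assms in \<open>auto intro: order_trans[OF degree_monom_le]\<close>)
  ultimately have "p = 0"
    using card_poly_roots_bound[of p] by auto
  moreover have "Polynomial.coeff p k = of_nat (?q choose k)"
    using assms by (simp add: p_def coeff_sum)
  ultimately show ?thesis
    by simp
qed

text \<open>The vanishing of the inner binomial coefficients passes from the base field to its
  closure along \<open>to_ac\<close>, so only the two outer terms of the expansion survive.\<close>

lemma frobenius_add:
  fixes x y :: "'a::{field,finite} alg_closure"
  shows "(x + y) ^ CARD('a) = x ^ CARD('a) + y ^ CARD('a)"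
proof -
  let ?q = "CARD('a)"
  have 0: "of_nat (?q choose k) = (0 :: 'a alg_closure)" if "k \<in> {0<..<?q}" for k
    using of_nat_card_choose[where 'a = 'a, of k] that
    by (metis greaterThanLessThan_iff to_ac_0 to_ac_of_nat)
  have "(x + y) ^ ?q = (\<Sum>k\<le>?q. of_nat (?q choose k) * x ^ k * y ^ (?q - k))"
    by (rule binomial_ring)
  also have "{..?q} = insert 0 (insert ?q {0<..<?q})"
    by auto
  also have "(\<Sum>k\<in>\<dots>. of_nat (?q choose k) * x ^ k * y ^ (?q - k)) = x ^ ?q + y ^ ?q"
    using 0 finite_UNIV_card_ge_0[where ?'a = 'a] by simp
  finally show ?thesis .
qed

lemma frobenius_power_add:
  fixes x y :: "'a::{field,finite} alg_closure"
  shows "(x + y) ^ (CARD('a) ^ n) = x ^ (CARD('a) ^ n) + y ^ (CARD('a) ^ n)"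
  by (induction n) (simp_all add: power_mult frobenius_add mult.commute[of "CARD('a)"])

text \<open>The roots of X^(q^n) - X in the closure, that is, the subfield with q^n elements when
  \<open>n\<close> is positive. For \<open>n = 0\<close> it is the whole closure.\<close>

definition power_fixed :: "nat \<Rightarrow> 'a::{field,finite} alg_closure set" where
  "power_fixed n = {x. x ^ (CARD('a) ^ n) = x}"

lemma power_fixed_0 [simp]: "0 \<in> power_fixed n"
  and power_fixed_1 [simp]: "1 \<in> power_fixed n"
  by (auto simp: power_fixed_def)

lemma power_fixed_add: "x \<in> power_fixed n \<Longrightarrow> y \<in> power_fixed n \<Longrightarrow> x + y \<in> power_fixed n"
  by (simp add: power_fixed_def frobenius_power_add)

lemma power_fixed_mult: "x \<in> power_fixed n \<Longrightarrow> y \<in> power_fixed n \<Longrightarrow> x * y \<in> power_fixed n"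
  by (simp add: power_fixed_def power_mult_distrib)

lemma power_fixed_divide: "x \<in> power_fixed n \<Longrightarrow> y \<in> power_fixed n \<Longrightarrow> x / y \<in> power_fixed n"
  by (simp add: power_fixed_def power_divide)

lemma to_ac_power_fixed: "to_ac c \<in> power_fixed n"
proof -
  have "c ^ (CARD('a) ^ n) = c"
    by (induction n) (simp_all add: power_mult field_power_card)
  then show ?thesis
    by (simp add: power_fixed_def flip: to_ac_power)
qed

text \<open>What the \<open>n\<close>-th power of Frobenius fixes is also fixed by applying it
  \<open>h\<close> times; this is the subfield inclusion behind the spread.\<close>

lemma power_fixed_mono:
  "(power_fixed n :: 'a::{field,finite} alg_closure set) \<subseteq> power_fixed (h * n)"
proof
  fix x :: "'a alg_closure" assume "x \<in> power_fixed n"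
  then have "x ^ (CARD('a) ^ n) = x" by (simp add: power_fixed_def)
  then have "x ^ (CARD('a) ^ (h * n)) = x"
    by (induction h) (simp_all add: power_add power_mult)
  then show "x \<in> power_fixed (h * n)" by (simp add: power_fixed_def)
qed

text \<open>The linear factors of a nonzero polynomial form a multiset of roots as large as the
  degree. A double root would also be a root of the derivative, so this multiset has no
  repetitions.\<close>

lemma card_alg_closed_roots:
  fixes p :: "'a::alg_closed_field poly"
  assumes "p \<noteq> 0" and simple: "\<And>x. poly p x = 0 \<Longrightarrow> poly (pderiv p) x \<noteq> 0"
  shows "card {x. poly p x = 0} = Polynomial.degree p"
proof -
  define c where "c = Polynomial.lead_coeff p"
  obtain A where A: "size A = Polynomial.degree p" "p = smult c (\<Prod>x\<in>#A. [:-x, 1:])"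
    using alg_closed_imp_factorization[OF \<open>p \<noteq> 0\<close>] unfolding c_def by blast
  have root_iff: "poly p x = 0 \<longleftrightarrow> x \<in># A" for x
  proof -
    have "poly (\<Prod>y\<in>#B. [:-y, 1:]) x = 0 \<longleftrightarrow> x \<in># B" for B
      by (induction B) auto
    moreover have "c \<noteq> 0"
      using assms(1) by (simp add: c_def)
    ultimately show ?thesis
      by (subst A(2)) simp
  qed
  have "count A x = 1" if "x \<in># A" for x
  proof (rule ccontr)
    assume "count A x \<noteq> 1"
    obtain B where B: "A = add_mset x B"
      using \<open>x \<in># A\<close> by (meson multi_member_split)
    with \<open>count A x \<noteq> 1\<close> have "x \<in># B"
      by (auto simp: not_in_iff)
    then obtain C where C: "B = add_mset x C"
      by (meson multi_member_split)
    \<comment> \<open>With two equal factors pulled out, each term of the derivative keeps one of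
      them and vanishes at \<open>x\<close>.\<close>
    have "p = smult c ([:-x, 1:] * ([:-x, 1:] * (\<Prod>x\<in>#C. [:-x, 1:])))"
      by (simp add: A(2)[unfolded B C])
    then have "poly (pderiv p) x = 0"
      by (simp only: pderiv_smult pderiv_mult poly_smult poly_add poly_mult) simp
    then show False
      using simple root_iff that by blast
  qed
  then have "size A = card (set_mset A)"
    by (simp add: size_multiset_overloaded_eq)
  also have "set_mset A = {x. poly p x = 0}"
    using root_iff by auto
  finally show ?thesis
    using A(1) by simp
qed

text \<open>The order of a finite field is zero in the field, so X^(q^n) - X has derivative -1 and
  only simple roots.\<close>

lemma card_power_fixed:
  assumes "0 < n"
  shows "card (power_fixed n :: 'a::{field,finite} alg_closure set) = CARD('a) ^ n"
proof -
  let ?Q = "CARD('a) ^ n"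
  define p :: "'a alg_closure poly" where "p = Polynomial.monom 1 ?Q - Polynomial.monom 1 1"
  \<comment> \<open>The case \<open>k = 1\<close> of the binomial lemma, which applies because 1 <
    q.\<close>
  have "of_nat CARD('a) = (0 :: 'a)"
    using of_nat_card_choose[where 'a = 'a, of 1] two_le_CARD[where 'a = 'a] by simp
  then have "of_nat CARD('a) = (0 :: 'a alg_closure)"
    by (metis to_ac_0 to_ac_of_nat)
  then have "pderiv p = -1"
    using assms by (simp add: p_def pderiv_diff pderiv_monom)
  moreover have "1 < ?Q"
    using one_less_power[of "CARD('a)" n] two_le_CARD[where 'a = 'a] assms by linarith
  then have deg: "Polynomial.degree p = ?Q"
    unfolding p_def diff_conv_add_uminus
    by (subst degree_add_eq_left) (auto simp: degree_monom_eq)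
  then have "p \<noteq> 0"
    using \<open>1 < ?Q\<close> by auto
  moreover have "{x. poly p x = 0} = power_fixed n"
    by (auto simp: p_def poly_monom power_fixed_def)
  ultimately show ?thesis
    using card_alg_closed_roots[of p] deg \<open>p \<noteq> 0\<close> by auto
qed

section \<open>Linear codes over a finite field\<close>

lemma card_carrier_vec: "card (carrier_vec n :: 'a::finite vec set) = CARD('a) ^ n"
proof -
  have "bij_betw (vec n) ({..<n} \<rightarrow>\<^sub>E UNIV) (carrier_vec n :: 'a vec set)"
    by (rule bij_betw_byWitness[where f' = "\<lambda>v. \<lambda>i\<in>{..<n}. v $ i"])
      (auto simp: PiE_def extensional_def)
  from bij_betw_same_card[OF this] show ?thesis
    by (simp add: card_PiE)
qed

lemma finite_carrier_vec: "finite (carrier_vec n :: 'a::finite vec set)"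
  by (rule card_ge_0_finite) (simp add: card_carrier_vec finite_UNIV_card_ge_0)

text \<open>Forming linear combinations of a basis is a bijection from extensional coefficient
  functions onto the space. This lets later arguments compute dimensions by counting.\<close>

lemma (in vectorspace) card_carrier_eq_power_dim:
  assumes "fin_dim" "finite (carrier K)"
  shows "card (carrier V) = card (carrier K) ^ dim"
proof -
  obtain B where B: "finite B" "basis B"
    using finite_basis_exists[OF assms(1)] by blast
  then have "B \<subseteq> carrier V"
    by (simp add: basis_def)
  have closed: "lincomb a B \<in> carrier V" if "a \<in> B \<rightarrow>\<^sub>E carrier K" for a
    using that \<open>B \<subseteq> carrier V\<close> by (intro lincomb_closed) (auto simp: PiE_def)
  have ex1: "\<exists>!a. a \<in> B \<rightarrow>\<^sub>E carrier K \<and> lincomb a B = v" if "v \<in> carrier V" for v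
    using iffD1[OF basis_criterion[OF B(1) \<open>B \<subseteq> carrier V\<close>] B(2)] that by simp
  have "bij_betw (\<lambda>a. lincomb a B) (B \<rightarrow>\<^sub>E carrier K) (carrier V)"
  proof (rule bij_betw_imageI)
    show "inj_on (\<lambda>a. lincomb a B) (B \<rightarrow>\<^sub>E carrier K)"
    proof (rule inj_onI)
      fix a b assume ab: "a \<in> B \<rightarrow>\<^sub>E carrier K" "b \<in> B \<rightarrow>\<^sub>E carrier K" "lincomb a B = lincomb b B"
      show "a = b"
        using the1_equality[OF ex1[OF closed[OF ab(2)]], OF conjI[OF ab(1,3)]]
          the1_equality[OF ex1[OF closed[OF ab(2)]], OF conjI[OF ab(2) refl]] by simp
    qed
    show "(\<lambda>a. lincomb a B) ` (B \<rightarrow>\<^sub>E carrier K) = carrier V"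
    proof (intro subset_antisym subsetI)
      fix v assume "v \<in> carrier V"
      from ex1_implies_ex[OF ex1[OF this]] show "v \<in> (\<lambda>a. lincomb a B) ` (B \<rightarrow>\<^sub>E carrier K)"
        by (elim exE conjE) (rule image_eqI[OF sym])
    qed (use closed in \<open>elim imageE; simp\<close>)
  qed
  from bij_betw_same_card[OF this] show ?thesis
    using B by (simp add: card_PiE dim_basis)
qed

section \<open>Codes through closure conditions and cardinalities\<close>

lemma linear_code_iff:
  fixes C :: "'a::field vec set"
  shows "linear_code n C \<longleftrightarrow> C \<subseteq> carrier_vec n \<and> 0\<^sub>v n \<in> C \<and>
    (\<forall>x\<in>C. \<forall>y\<in>C. x + y \<in> C) \<and> (\<forall>a. \<forall>x\<in>C. a \<cdot>\<^sub>v x \<in> C)"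
  unfolding linear_code_def VectorSpace.subspace_def submodule_def module_vec_simps
  using vec_vs[where 'a = 'a and n = n] vec_module[where 'a = 'a and n = n] by auto

lemmas linear_codeD =
  linear_code_iff[THEN iffD1, THEN conjunct1]
  linear_code_iff[THEN iffD1, THEN conjunct2, THEN conjunct1]
  linear_code_iff[THEN iffD1, THEN conjunct2, THEN conjunct2, THEN conjunct1, rule_format]
  linear_code_iff[THEN iffD1, THEN conjunct2, THEN conjunct2, THEN conjunct2, rule_format]

lemma linear_code_diff:
  assumes "linear_code n C" "x \<in> C" "y \<in> C"
  shows "x - y \<in> C"
proof -
  have "x + (-1) \<cdot>\<^sub>v y \<in> C"
    using assms by (intro linear_codeD(3,4)[OF assms(1)])
  also have "x + (-1) \<cdot>\<^sub>v y = x - y"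
  proof -
    have "x \<in> carrier_vec n" "y \<in> carrier_vec n"
      using linear_codeD(1)[OF assms(1)] assms(2,3) by blast+
    then show ?thesis
      by (intro eq_vecI) auto
  qed
  finally show ?thesis .
qed

lemma card_linear_code:
  fixes C :: "'a::{field,finite} vec set"
  assumes "linear_code n C"
  shows "card C = CARD('a) ^ code_dim n C"
proof -
  interpret vec_space "TYPE('a)" n .
  have sub: "VectorSpace.subspace class_ring C V"
    using assms by (simp add: linear_code_def)
  interpret C: vectorspace class_ring "vs C"
    using sub by (rule subspace_is_vs)
  have "finite C"
    using linear_codeD(1)[OF assms] finite_carrier_vec by (rule finite_subset)
  \<comment> \<open>A finite code spans itself, so it serves as its own finite generating
    set.\<close>
  then have "C.fin_dim"
    unfolding C.fin_dim_def using C.in_own_span[of C] C.span_closed[of C]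
    by (intro exI[of _ C]) auto
  from C.card_carrier_eq_power_dim[OF this] show ?thesis
    by (simp add: code_dim_def class_ring_simps)
qed

text \<open>Comparing cardinalities bounds the dimension by \<open>n\<close>, so the truncated
  subtraction in \<open>redundancy\<close> is exact, and q to the redundancy is the index of the
  code.\<close>

lemma card_linear_code_redundancy:
  fixes C :: "'a::{field,finite} vec set"
  assumes "linear_code n C"
  shows "card C * CARD('a) ^ redundancy n C = CARD('a) ^ n"
    and "code_dim n C \<le> n"
proof -
  have "CARD('a) ^ code_dim n C \<le> CARD('a) ^ n"
    using card_mono[OF finite_carrier_vec linear_codeD(1)[OF assms]]
    by (simp add: card_linear_code[OF assms] card_carrier_vec)
  moreover have "1 < CARD('a)"
    using two_le_CARD[where 'a = 'a] by simp
  ultimately show "code_dim n C \<le> n"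
    by simp
  then show "card C * CARD('a) ^ redundancy n C = CARD('a) ^ n"
    by (simp add: card_linear_code[OF assms] redundancy_def flip: power_add)
qed

section \<open>Desarguesian spreads\<close>

lemma power_fixed_sum:
  "(\<And>i. i \<in> I \<Longrightarrow> f i \<in> power_fixed n) \<Longrightarrow> (\<Sum>i\<in>I. f i) \<in> power_fixed n"
  by (induction I rule: infinite_finite_induct) (simp_all add: power_fixed_add)

text \<open>A maximal independent subset of the fixed field is a basis over the base field, and
  counting the field in two ways shows that it has \<open>n\<close> elements.\<close>

lemma power_fixed_basis:
  assumes "0 < n"
  obtains \<beta> where "bij_betw (\<lambda>x :: 'a::{field,finite} vec. \<Sum>j<n. to_ac (x $ j) * \<beta> j)
    (carrier_vec n) (power_fixed n)"
proof -
  \<comment> \<open>The closure is a vector space over \<open>'a\<close>, with scalars acting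
    through \<open>to_ac\<close>.\<close>
  interpret ac: vector_space "\<lambda>c x. to_ac c * x :: 'a alg_closure"
    by unfold_locales (simp_all add: algebra_simps)
  let ?K = "power_fixed n :: 'a alg_closure set"
  obtain B where B: "B \<subseteq> ?K" "ac.independent B" "?K \<subseteq> ac.span B"
    using ac.maximal_independent_subset[of ?K] by blast
  have "finite ?K"
    using card_power_fixed[OF assms, where 'a = 'a] two_le_CARD[where 'a = 'a]
    by (intro card_ge_0_finite) simp
  then have "finite B"
    using B(1) finite_subset by blast
  define d where "d = card B"
  obtain \<beta> where \<beta>: "bij_betw \<beta> {..<d} B"
    using ex_bij_betw_nat_finite[OF \<open>finite B\<close>] unfolding d_def atLeast0LessThan by blast
  define \<iota> where "\<iota> = inv_into {..<d} \<beta>"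
  have \<iota>: "\<iota> (\<beta> j) = j" if "j < d" for j
    using \<beta> that by (simp add: \<iota>_def bij_betw_def inv_into_f_f)
  have sum_eq: "(\<Sum>b\<in>B. to_ac (f b) * b) = (\<Sum>j<d. to_ac (f (\<beta> j)) * \<beta> j)" for f
    using sum.reindex_bij_betw[OF \<beta>, of "\<lambda>b. to_ac (f b) * b"] by simp
  have bij: "bij_betw (\<lambda>x. \<Sum>j<d. to_ac (x $ j) * \<beta> j) (carrier_vec d) ?K"
  proof (rule bij_betw_imageI)
    show "inj_on (\<lambda>x. \<Sum>j<d. to_ac (x $ j) * \<beta> j) (carrier_vec d)"
    proof (rule inj_onI)
      fix x y :: "'a vec"
      assume xy: "x \<in> carrier_vec d" "y \<in> carrier_vec d"
        and eq: "(\<Sum>j<d. to_ac (x $ j) * \<beta> j) = (\<Sum>j<d. to_ac (y $ j) * \<beta> j)"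
      \<comment> \<open>The difference of the coordinates, indexed by the elements of
        \<open>B\<close> so that independence applies to it.\<close>
      define u where "u b = x $ \<iota> b - y $ \<iota> b" for b
      have "(\<Sum>b\<in>B. to_ac (u b) * b) = (\<Sum>j<d. to_ac (x $ j - y $ j) * \<beta> j)"
        unfolding sum_eq by (intro sum.cong) (simp_all add: u_def \<iota>)
      also have "\<dots> = 0"
        using eq by (simp add: left_diff_distrib sum_subtractf)
      finally have zero: "(\<Sum>b\<in>B. to_ac (u b) * b) = 0" .
      have "x $ j = y $ j" if "j < d" for j
      proof -
        have "\<beta> j \<in> B"
          using \<beta> that by (auto simp: bij_betw_def)
        then have "u (\<beta> j) = 0"
          using ac.independentD[OF B(2) \<open>finite B\<close> order_refl zero] by blast
        then show ?thesis
          using that by (simp add: u_def \<iota>)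
      qed
      then show "x = y"
        using xy by (intro eq_vecI) auto
    qed
    show "(\<lambda>x. \<Sum>j<d. to_ac (x $ j) * \<beta> j) ` carrier_vec d = ?K"
    proof (intro subset_antisym image_subsetI subsetI)
      fix x :: "'a vec"
      show "(\<Sum>j<d. to_ac (x $ j) * \<beta> j) \<in> ?K"
        using \<beta> B(1)
        by (intro power_fixed_sum power_fixed_mult to_ac_power_fixed) (auto simp: bij_betw_def)
    next
      fix v assume "v \<in> ?K"
      then have "v \<in> range (\<lambda>u. \<Sum>b\<in>B. to_ac (u b) * b)"
        using B(3) ac.span_finite[OF \<open>finite B\<close>] by blast
      then obtain u where "v = (\<Sum>b\<in>B. to_ac (u b) * b)"
        by blast
      also have "\<dots> = (\<Sum>j<d. to_ac (vec d (\<lambda>j. u (\<beta> j)) $ j) * \<beta> j)"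
        by (simp add: sum_eq)
      finally show "v \<in> (\<lambda>x. \<Sum>j<d. to_ac (x $ j) * \<beta> j) ` carrier_vec d"
        by (rule image_eqI) simp
    qed
  qed
  \<comment> \<open>Both sides count the field, once by coordinates and once as a set of
    roots.\<close>
  from bij_betw_same_card[OF this] have "CARD('a) ^ d = CARD('a) ^ n"
    by (simp add: card_carrier_vec card_power_fixed[OF assms])
  then have "d = n"
    using two_le_CARD[where 'a = 'a] by (simp add: power_inject_exp)
  with bij that show thesis
    by blast
qed

text \<open>\<open>\<gamma> i\<close> is a basis of the \<open>i\<close>-th member of the spread over the field with \<open>q\<close> elements.\<close>

lemma desarguesian_spread:
  assumes "0 < N" "0 < h"
  obtains L :: nat and \<gamma> where
    "bij_betw (\<lambda>(i, x :: 'a::{field,finite} vec). \<Sum>j<N. to_ac (x $ j) * \<gamma> i j)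
      ({..<L} \<times> (carrier_vec N - {0\<^sub>v N})) (power_fixed (h * N) - {0})"
proof -
  let ?K = "power_fixed N :: 'a alg_closure set"
  let ?W = "power_fixed (h * N) - {0 :: 'a alg_closure}"
  have K_sub: "?K \<subseteq> power_fixed (h * N)"
    by (rule power_fixed_mono)
  \<comment> \<open>Picks one point on the line through \<open>v\<close> over the subfield. The
    choice predicate is the same for all nonzero points of that line, so proportional elements get
    the same representative.\<close>
  define rep where "rep v = (SOME w. w \<in> ?W \<and> v / w \<in> ?K)" for v
  have rep: "rep v \<in> ?W" "v / rep v \<in> ?K" if "v \<in> ?W" for v
  proof -
    have "v \<in> ?W \<and> v / v \<in> ?K"
      using that by simp
    then have "rep v \<in> ?W \<and> v / rep v \<in> ?K"
      unfolding rep_def by (rule someI)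
    then show "rep v \<in> ?W" "v / rep v \<in> ?K"
      by simp_all
  qed
  have rep_eq: "rep v = rep v'" if "v \<noteq> 0" "v' \<noteq> 0" "v / v' \<in> ?K" for v v'
  proof -
    have "v / w \<in> ?K \<longleftrightarrow> v' / w \<in> ?K" for w
    proof -
      have "v / w = (v / v') * (v' / w)" "v' / w = (v / w) / (v / v')"
        using that by simp_all
      then show ?thesis
        using power_fixed_mult power_fixed_divide that(3) by metis
    qed
    then show ?thesis
      by (simp add: rep_def)
  qed
  define P where "P = rep ` ?W"
  have "finite ?W"
    using card_power_fixed[of "h * N", where 'a = 'a] two_le_CARD[where 'a = 'a] assms
    by (intro finite_Diff card_ge_0_finite) simp
  then have "finite P"
    by (simp add: P_def)
  then obtain p where p: "bij_betw p {..<card P} P"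
    using ex_bij_betw_nat_finite[of P] unfolding atLeast0LessThan by blast
  obtain \<beta> where \<beta>: "bij_betw (\<lambda>x :: 'a vec. \<Sum>j<N. to_ac (x $ j) * \<beta> j) (carrier_vec N) ?K"
    using power_fixed_basis[OF assms(1)] .
  define \<phi> where "\<phi> x = (\<Sum>j<N. to_ac (x $ j) * \<beta> j)" for x :: "'a vec"
  have \<phi>0: "\<phi> (0\<^sub>v N) = 0"
    by (simp add: \<phi>_def)
  have \<phi>: "bij_betw \<phi> (carrier_vec N - {0\<^sub>v N}) (?K - {0})"
    using bij_betw_DiffI[of \<phi> "carrier_vec N" ?K "{0\<^sub>v N}" "{0}"] \<beta> \<phi>0
    unfolding \<phi>_def[abs_def] by (simp add: bij_betw_def)
  have P_sub: "P \<subseteq> ?W"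
    using rep by (auto simp: P_def)
  \<comment> \<open>The partition into lines: a point determines both its representative and its
    scalar.\<close>
  have lines: "bij_betw (\<lambda>(w, x). x * w) (P \<times> (?K - {0})) ?W"
  proof (rule bij_betw_imageI)
    show "inj_on (\<lambda>(w, x). x * w) (P \<times> (?K - {0}))"
    proof (rule inj_onI)
      fix z z'
      assume z: "z \<in> P \<times> (?K - {0})" "z' \<in> P \<times> (?K - {0})"
        and "(\<lambda>(w, x). x * w) z = (\<lambda>(w, x). x * w) z'"
      then obtain w x w' x' where z_eq: "z = (w, x)" "z' = (w', x')" and eq: "x * w = x' * w'"
        by (cases z; cases z') auto
      then have w: "w \<in> P" "w' \<in> P" and x: "x \<in> ?K" "x \<noteq> 0" "x' \<in> ?K" "x' \<noteq> 0"
        using z by auto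
      obtain v v' where v: "v \<in> ?W" "w = rep v" "v' \<in> ?W" "w' = rep v'"
        using w by (auto simp: P_def)
      have nz: "v \<noteq> 0" "v' \<noteq> 0" "w \<noteq> 0" "w' \<noteq> 0"
        using v rep[of v] rep[of v'] by auto
      \<comment> \<open>Each of \<open>v\<close> and \<open>v'\<close> is a subfield multiple of its
        representative, so equal products make them proportional over the subfield, which forces
        equal representatives.\<close>
      have "v / v' = ((v / w) * (x' / x)) / (v' / w')"
        using eq nz x by (simp add: field_simps)
      also have "\<dots> \<in> ?K"
        using rep(2)[OF v(1)] rep(2)[OF v(3)] power_fixed_divide[OF x(3,1)] unfolding v(2,4)
        by (metis power_fixed_divide power_fixed_mult)
      finally have "w = w'"
        using rep_eq nz v by metis
      then show "z = z'"
        using eq nz z_eq by simp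
    qed
    show "(\<lambda>(w, x). x * w) ` (P \<times> (?K - {0})) = ?W"
    proof (intro subset_antisym image_subsetI subsetI)
      fix z assume "z \<in> P \<times> (?K - {0})"
      then show "(case z of (w, x) \<Rightarrow> x * w) \<in> ?W"
        using P_sub K_sub by (auto intro!: power_fixed_mult)
    next
      fix v assume v: "v \<in> ?W"
      then have "rep v \<noteq> 0" "v = v / rep v * rep v"
        using rep[OF v] by auto
      then show "v \<in> (\<lambda>(w, x). x * w) ` (P \<times> (?K - {0}))"
        using v rep[OF v] by (intro image_eqI[of _ _ "(rep v, v / rep v)"]) (auto simp: P_def)
    qed
  qed
  have "bij_betw ((\<lambda>(w, x). x * w) \<circ> map_prod p \<phi>)
      ({..<card P} \<times> (carrier_vec N - {0\<^sub>v N})) ?W"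
    by (rule bij_betw_trans[OF bij_betw_map_prod[OF p \<phi>] lines])
  \<comment> \<open>Expanding the scalar in the basis \<open>\<beta>\<close> gives the
    \<open>i\<close>-th line the basis \<open>\<beta> j * p i\<close>.\<close>
  also have "(\<lambda>(w, x). x * w) \<circ> map_prod p \<phi>
      = (\<lambda>(i, x). \<Sum>j<N. to_ac (x $ j) * (\<beta> j * p i))"
    by (auto simp: fun_eq_iff \<phi>_def sum_distrib_right mult.assoc)
  finally show thesis
    by (rule that[of "\<lambda>i j. \<beta> j * p i"])
qed

section \<open>The sum-rank metric\<close>

text \<open>A single row is an outer product, which bounds the rank by 1; a nonzero entry gives a
  column that is independent by itself.\<close>

lemma rank_row_vector:
  fixes v :: "'a::field vec"
  assumes "v \<in> carrier_vec N"
  shows "vec_space.rank 1 (mat_of_rows N [v]) = (if v = 0\<^sub>v N then 0 else 1)"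
proof -
  interpret vec_space "TYPE('a)" 1 .
  let ?A = "mat_of_rows N [v]"
  have A: "?A \<in> carrier_mat 1 N"
    by (simp add: mat_of_rows_def)
  have le: "rank ?A \<le> 1"
    by (rule rank_le_1_product_entries[where f = "\<lambda>_. 1" and g = "\<lambda>j. v $ j", OF A])
      (auto simp: mat_of_rows_def)
  show ?thesis
  proof (cases "v = 0\<^sub>v N")
    case True
    then have "?A = 0\<^sub>m 1 N"
      by (intro eq_matI) (auto simp: mat_of_rows_def)
    then show ?thesis
      using True rank_0I[of N] by simp
  next
    case False
    then obtain j where j: "j < N" "v $ j \<noteq> 0"
      using assms by (metis carrier_vecD eq_vecI index_zero_vec)
    have col: "col ?A j \<in> set (cols ?A)" "col ?A j \<noteq> 0\<^sub>v 1"
    proof -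
      show "col ?A j \<in> set (cols ?A)"
        using j by (metis A carrier_matD(2) cols_length cols_nth nth_mem)
      have "col ?A j $ 0 = v $ j"
        using j by (simp add: mat_of_rows_def)
      moreover have "col ?A j $ 0 = 0" if "col ?A j = 0\<^sub>v 1"
        using that by (simp only: index_zero_vec zero_less_one)
      ultimately show "col ?A j \<noteq> 0\<^sub>v 1"
        using j by metis
    qed
    have "{col ?A j} \<subseteq> carrier_vec 1"
      using A by (simp add: carrier_vecI)
    then have "lin_indpt {col ?A j}"
      using lindep_span[of "{col ?A j}"] col(2) span_empty by (simp del: One_nat_def)
    then have "1 \<le> rank ?A"
      using rank_ge_card_indpt[OF A, of "{col ?A j}"] col(1) by simp
    then show ?thesis
      using le False by simp
  qed
qed

lemma block_carrier [simp]: "block N c i \<in> carrier_vec N"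
  by (simp add: block_def)

lemma wt_SR_eq: "wt_SR l N c = card {i. i < l \<and> block N c i \<noteq> 0\<^sub>v N}"
proof -
  have "wt_SR l N c = (\<Sum>i<l. if block N c i = 0\<^sub>v N then 0 else 1)"
    unfolding wt_SR_def by (intro sum.cong) (simp_all add: rank_row_vector del: One_nat_def)
  also have "\<dots> = card {i. i < l \<and> block N c i \<noteq> 0\<^sub>v N}"
    by (simp add: sum.If_cases Int_def)
  finally show ?thesis .
qed

lemma d_SR_ge_iff: "d_SR l N C \<ge> enat d \<longleftrightarrow> (\<forall>c\<in>C. c \<noteq> 0\<^sub>v (l * N) \<longrightarrow> d \<le> wt_SR l N c)"
  unfolding d_SR_def by (auto simp: le_INF_iff)

section \<open>Words as sequences of blocks\<close>

lemma block_index_less: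
  assumes "i < l" "j < N"
  shows "i * N + j < l * (N::nat)"
proof -
  have "i * N + j < Suc i * N"
    using assms by simp
  also have "\<dots> \<le> l * N"
    using assms by (intro mult_le_mono1) simp
  finally show ?thesis .
qed

lemma blocks_eqI:
  assumes "c \<in> carrier_vec (l * N)" "d \<in> carrier_vec (l * N)"
    and "\<And>i. i < l \<Longrightarrow> block N c i = block N d i"
  shows "c = d"
proof (rule eq_vecI)
  fix t assume "t < dim_vec d"
  then have t: "t < l * N"
    using assms(2) by simp
  then have "0 < N"
    by (cases N) auto
  then have "block N c (t div N) $ (t mod N) = block N d (t div N) $ (t mod N)"
    using assms(3)[of "t div N"] t by (simp add: less_mult_imp_div_less)
  then show "c $ t = d $ t"
    using \<open>0 < N\<close> by (simp add: block_def mult.commute)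
qed (use assms in auto)

lemma block_add:
  assumes "c \<in> carrier_vec (l * N)" "d \<in> carrier_vec (l * N)" "i < l"
  shows "block N (c + d) i = block N c i + block N d i"
  using assms by (intro eq_vecI) (auto simp: block_def block_index_less)

lemma block_diff:
  assumes "c \<in> carrier_vec (l * N)" "d \<in> carrier_vec (l * N)" "i < l"
  shows "block N (c - d) i = block N c i - block N d i"
  using assms by (intro eq_vecI) (auto simp: block_def block_index_less)

lemma block_smult:
  assumes "c \<in> carrier_vec (l * N)" "i < l"
  shows "block N (a \<cdot>\<^sub>v c) i = a \<cdot>\<^sub>v block N c i"
  using assms by (intro eq_vecI) (auto simp: block_def block_index_less)

lemma block_zero [simp]: "i < l \<Longrightarrow> block N (0\<^sub>v (l * N)) i = 0\<^sub>v N"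
  by (intro eq_vecI) (auto simp: block_def block_index_less)

text \<open>For \<open>i < l\<close> these are the words of weight at most one. They are the error
  patterns of the packing bound and also supply words for all nonzero syndromes.\<close>

definition single_block :: "nat \<Rightarrow> nat \<Rightarrow> nat \<Rightarrow> 'a::zero vec \<Rightarrow> 'a vec" where
  "single_block l N i x = vec (l * N) (\<lambda>t. if t div N = i then x $ (t mod N) else 0)"

lemma single_block_carrier [simp]: "single_block l N i x \<in> carrier_vec (l * N)"
  by (simp add: single_block_def)

lemma block_single_block:
  assumes "x \<in> carrier_vec N" "k < l"
  shows "block N (single_block l N i x) k = (if k = i then x else 0\<^sub>v N)"
  using assms by (intro eq_vecI) (auto simp: block_def single_block_def block_index_less)

section \<open>The length of proper Hamming codes\<close>

text \<open>The difference of the two words is a codeword of weight at most 2, hence zero. The set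
  \<open>A\<close> lets the differing blocks be bounded by any convenient superset.\<close>

lemma d_SR_3_eqI:
  assumes C: "linear_code (l * N) C" "3 \<le> d_SR l N C" and cd: "c \<in> C" "d \<in> C"
    and "finite A" "card A \<le> 2" "{i. i < l \<and> block N c i \<noteq> block N d i} \<subseteq> A"
  shows "c = d"
proof -
  have carrier: "c \<in> carrier_vec (l * N)" "d \<in> carrier_vec (l * N)"
    using linear_codeD(1)[OF C(1)] cd by blast+
  have "{i. i < l \<and> block N (c - d) i \<noteq> 0\<^sub>v N} \<subseteq> {i. i < l \<and> block N c i \<noteq> block N d i}"
    by (auto simp: block_diff[OF carrier])
  then have "wt_SR l N (c - d) \<le> card A"
    unfolding wt_SR_eq using assms(5,7) by (intro card_mono) auto
  then have "\<not> 3 \<le> wt_SR l N (c - d)"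
    using assms(6) by simp
  moreover have "enat 3 \<le> d_SR l N C"
    using C(2) by (simp add: numeral_eq_enat)
  ultimately have zero: "c - d = 0\<^sub>v (l * N)"
    using linear_code_diff[OF C(1) cd] unfolding d_SR_ge_iff by blast
  show ?thesis
  proof (rule eq_vecI)
    fix t assume "t < dim_vec d"
    then have "(c - d) $ t = 0"
      using zero carrier by simp
    then show "c $ t = d $ t"
      using \<open>t < dim_vec d\<close> carrier by simp
  qed (use carrier in simp)
qed

lemma vec_add_left_imp_eq:
  fixes c :: "'a::field vec"
  assumes "c \<in> carrier_vec n" "x \<in> carrier_vec n" "y \<in> carrier_vec n" "c + x = c + y"
  shows "x = y"
proof (rule eq_vecI)
  fix t assume "t < dim_vec y"
  then have "(c + x) $ t = c $ t + x $ t" "(c + y) $ t = c $ t + y $ t"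
    using assms(1-3) by auto
  then show "x $ t = y $ t"
    using assms(4) by (metis add_left_cancel)
qed (use assms in simp)

lemma inj_on_single_block:
  "inj_on (\<lambda>(i, x). single_block l N i x) ({..<l} \<times> (carrier_vec N - {0\<^sub>v N}))"
proof (rule inj_onI)
  fix z z' :: "nat \<times> 'a vec"
  assume z: "z \<in> {..<l} \<times> (carrier_vec N - {0\<^sub>v N})" "z' \<in> {..<l} \<times> (carrier_vec N - {0\<^sub>v N})"
    and eq: "(\<lambda>(i, x). single_block l N i x) z = (\<lambda>(i, x). single_block l N i x) z'"
  obtain i x i' x' where zz: "z = (i, x)" "z' = (i', x')"
    by (cases z; cases z')
  have "block N (single_block l N i x) i = block N (single_block l N i' x') i"
    using eq zz by simp
  then have "x = (if i = i' then x' else 0\<^sub>v N)"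
    using z zz block_single_block[of x N i l i] block_single_block[of x' N i l i'] by auto
  then show "z = z'"
    using z zz by (auto split: if_splits)
qed

text \<open>\<open>S\<close> is the ball of radius 1 around the zero word. Codewords whose
  translates meet differ in at most two blocks, so all sums \<open>c + s\<close> are distinct words;
  cancelling \<open>card C\<close> leaves the bound on \<open>card S\<close>.\<close>

lemma sphere_packing:
  fixes C :: "'a::{field,finite} vec set"
  assumes C: "linear_code (l * N) C" "3 \<le> d_SR l N C"
  shows "1 + l * (CARD('a) ^ N - 1) \<le> CARD('a) ^ redundancy (l * N) C"
proof -
  let ?n = "l * N"
  let ?I = "{..<l} \<times> (carrier_vec N - {0\<^sub>v N :: 'a vec})"
  define S where "S = insert (0\<^sub>v ?n) ((\<lambda>(i, x :: 'a vec). single_block l N i x) ` ?I)"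
  have "0\<^sub>v ?n \<notin> (\<lambda>(i, x :: 'a vec). single_block l N i x) ` ?I"
  proof
    assume "0\<^sub>v ?n \<in> (\<lambda>(i, x :: 'a vec). single_block l N i x) ` ?I"
    then obtain i x where "i < l" "x \<in> carrier_vec N" "x \<noteq> 0\<^sub>v N" "0\<^sub>v ?n = single_block l N i (x :: 'a vec)"
      by auto
    then show False
      using block_single_block[of x N i l i] block_zero[of i l N] by metis
  qed
  moreover have "card ?I = l * (CARD('a) ^ N - 1)"
    by (simp add: card_cartesian_product card_Diff_singleton finite_carrier_vec card_carrier_vec)
  moreover have "finite ?I"
    by (simp add: finite_carrier_vec)
  ultimately have card_S: "card S = 1 + l * (CARD('a) ^ N - 1)"
    unfolding S_def by (simp add: card_image[OF inj_on_single_block])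
  have S_carrier: "S \<subseteq> carrier_vec ?n"
    by (auto simp: S_def)
  have S_block: "\<exists>i. \<forall>k<l. k \<noteq> i \<longrightarrow> block N s k = 0\<^sub>v N" if "s \<in> S" for s
    using that by (auto simp: S_def block_single_block)
  have C_carrier: "C \<subseteq> carrier_vec ?n"
    by (rule linear_codeD(1)[OF C(1)])
  have "inj_on (\<lambda>(c, s). c + s) (C \<times> S)"
  proof (rule inj_onI)
    fix z z'
    assume z: "z \<in> C \<times> S" "z' \<in> C \<times> S" and "(\<lambda>(c, s). c + s) z = (\<lambda>(c, s). c + s) z'"
    then obtain c s c' s' where zz: "z = (c, s)" "z' = (c', s')" and eq: "c + s = c' + s'"
      by (cases z; cases z') auto
    have cs: "c \<in> C" "c' \<in> C" "s \<in> S" "s' \<in> S"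
      using z zz by auto
    then have car: "c \<in> carrier_vec ?n" "c' \<in> carrier_vec ?n" "s \<in> carrier_vec ?n" "s' \<in> carrier_vec ?n"
      using C_carrier S_carrier by auto
    obtain i i' where i: "\<forall>k<l. k \<noteq> i \<longrightarrow> block N s k = 0\<^sub>v N" "\<forall>k<l. k \<noteq> i' \<longrightarrow> block N s' k = 0\<^sub>v N"
      using S_block cs by metis
    \<comment> \<open>Outside the supports of \<open>s\<close> and \<open>s'\<close> the common sum
      shows the blocks of \<open>c\<close> and \<open>c'\<close> themselves.\<close>
    have "{k. k < l \<and> block N c k \<noteq> block N c' k} \<subseteq> {i, i'}"
    proof (rule subsetI, rule ccontr)
      fix k assume "k \<in> {k. k < l \<and> block N c k \<noteq> block N c' k}" "k \<notin> {i, i'}"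
      moreover from this have "block N (c + s) k = block N c k" "block N (c' + s') k = block N c' k"
        using i car by (simp_all add: block_add[of _ l])
      ultimately show False
        using eq by simp
    qed
    then have "c = c'"
      using d_SR_3_eqI[OF C cs(1,2), of "{i, i'}"] card_insert_le_m1[of 2 "{i'}" i] by simp
    then show "z = z'"
      using vec_add_left_imp_eq[OF car(1,3,4)] eq zz by simp
  qed
  moreover have "(\<lambda>(c, s). c + s) ` (C \<times> S) \<subseteq> carrier_vec ?n"
    using C_carrier S_carrier by (auto intro!: add_carrier_vec)
  ultimately have "card (C \<times> S) \<le> card (carrier_vec ?n :: 'a vec set)"
    by (rule card_inj_on_le[OF _ _ finite_carrier_vec])
  then have "card C * card S \<le> card C * CARD('a) ^ redundancy ?n C"
    by (simp add: card_cartesian_product card_carrier_vec card_linear_code_redundancy(1)[OF C(1)])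
  moreover have "0 < card C"
    using card_linear_code[OF C(1)] finite_UNIV_card_ge_0[where ?'a = 'a] by simp
  ultimately have "card S \<le> CARD('a) ^ redundancy ?n C"
    by simp
  then show ?thesis
    by (simp add: card_S)
qed

text \<open>The code is the kernel of a syndrome map into the field with q^(h N) elements that sends
  the \<open>i\<close>-th block into the \<open>i\<close>-th member of the spread. Distinct members
  meet only in zero, which excludes weight 2; together they cover the field, which makes the
  syndrome onto and fixes the redundancy.\<close>

lemma Hamming_code_exists:
  assumes "0 < N" "0 < h"
  obtains L and C :: "'a::{field,finite} vec set" where
    "linear_code (L * N) C" "3 \<le> d_SR L N C" "redundancy (L * N) C = h * N"
    "L * (CARD('a) ^ N - 1) = CARD('a) ^ (h * N) - 1"
proof -
  obtain L :: nat and \<gamma> where bij: "bij_betw (\<lambda>(i, x :: 'a vec). \<Sum>j<N. to_ac (x $ j) * \<gamma> i j)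
      ({..<L} \<times> (carrier_vec N - {0\<^sub>v N})) (power_fixed (h * N) - {0})"
    using desarguesian_spread[OF assms] by blast
  let ?n = "L * N"
  let ?W = "power_fixed (h * N) :: 'a alg_closure set"
  \<comment> \<open>\<open>f i\<close> identifies vectors of length \<open>N\<close> with the
    \<open>i\<close>-th spread member, and \<open>s\<close> is the syndrome.\<close>
  define f where "f i x = (\<Sum>j<N. to_ac (x $ j) * \<gamma> i j)" for i and x :: "'a vec"
  define s where "s c = (\<Sum>i<L. f i (block N c i))" for c
  have f_add: "f i (x + y) = f i x + f i y" if "x \<in> carrier_vec N" "y \<in> carrier_vec N" for i x y
    using that by (simp add: f_def algebra_simps sum.distrib)
  have f_smult: "f i (a \<cdot>\<^sub>v x) = to_ac a * f i x" if "x \<in> carrier_vec N" for i a x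
    using that by (simp add: f_def sum_distrib_left mult.assoc)
  have f_0: "f i (0\<^sub>v N) = 0" for i
    by (simp add: f_def)
  have bij_f: "bij_betw (\<lambda>(i, x). f i x) ({..<L} \<times> (carrier_vec N - {0\<^sub>v N})) (?W - {0})"
    using bij by (simp add: f_def)
  have f_W: "f i x \<in> ?W - {0}" if "i < L" "x \<in> carrier_vec N" "x \<noteq> 0\<^sub>v N" for i x
    using bij_betwE[OF bij_f] that by auto
  have s_W: "s c \<in> ?W" for c
    unfolding s_def
  proof (rule power_fixed_sum)
    fix i assume "i \<in> {..<L}"
    then show "f i (block N c i) \<in> ?W"
      using f_W[of i "block N c i"] f_0 by (cases "block N c i = 0\<^sub>v N") auto
  qed
  have s_add: "s (c + d) = s c + s d" if "c \<in> carrier_vec ?n" "d \<in> carrier_vec ?n" for c d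
    using that by (simp add: s_def block_add[of _ L] f_add sum.distrib)
  have s_smult: "s (a \<cdot>\<^sub>v c) = to_ac a * s c" if "c \<in> carrier_vec ?n" for a c
    using that by (simp add: s_def block_smult[of _ L] f_smult sum_distrib_left)
  have s_0: "s (0\<^sub>v ?n) = 0"
    by (simp add: s_def f_0)
  define C where "C = {c \<in> carrier_vec ?n. s c = 0}"
  have lin: "linear_code ?n C"
    unfolding linear_code_iff by (auto simp: C_def s_add s_smult s_0)
  have "enat 3 \<le> d_SR L N C"
    unfolding d_SR_ge_iff
  proof (intro ballI impI, rule ccontr)
    fix c assume c: "c \<in> C" "c \<noteq> 0\<^sub>v ?n" "\<not> 3 \<le> wt_SR L N c"
    define A where "A = {i. i < L \<and> block N c i \<noteq> 0\<^sub>v N}"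
    have "finite A"
      by (simp add: A_def)
    have "A \<noteq> {}"
      using c blocks_eqI[of c L N "0\<^sub>v ?n"] by (auto simp: A_def C_def)
    moreover have "card A \<le> 2"
      using c(3) by (simp add: wt_SR_eq A_def)
    ultimately have "card A = 1 \<or> card A = 2"
      using \<open>finite A\<close> by (cases "card A") auto
    have "0 = s c"
      using c(1) by (simp add: C_def)
    also have "\<dots> = (\<Sum>i\<in>A. f i (block N c i))"
      unfolding s_def by (rule sum.mono_neutral_right) (auto simp: A_def f_0)
    finally have sum_0: "(\<Sum>i\<in>A. f i (block N c i)) = 0" ..
    from \<open>card A = 1 \<or> card A = 2\<close> show False
    proof
      assume "card A = 1"
      then obtain i where "A = {i}"
        by (rule card_1_singletonE)
      then show False
        using sum_0 f_W[of i "block N c i"] by (auto simp: A_def)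
    next
      assume "card A = 2"
      then obtain i k where A: "A = {i, k}" "i \<noteq> k"
        by (auto simp: card_2_iff)
      \<comment> \<open>Negating one term turns a vanishing sum of two terms into an equality;
        injectivity of the spread parametrization then forces \<open>i = k\<close>.\<close>
      define y where "y = (-1) \<cdot>\<^sub>v block N c k"
      have ik: "i < L" "k < L" "block N c i \<noteq> 0\<^sub>v N" "block N c k \<noteq> 0\<^sub>v N"
        using A(1) by (auto simp: A_def)
      have "block N c k = (-1) \<cdot>\<^sub>v y"
        by (intro eq_vecI) (auto simp: y_def)
      then have "y \<noteq> 0\<^sub>v N"
        using ik(4) by auto
      have "f i (block N c i) = f k y"
        using sum_0 A by (simp add: y_def f_smult add_eq_0_iff2)
      then have "(i, block N c i) = (k, y)"
        using ik \<open>y \<noteq> 0\<^sub>v N\<close>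
        by (intro inj_onD[OF bij_betw_imp_inj_on[OF bij_f]]) (auto simp: y_def)
      then show False
        using A(2) by simp
    qed
  qed
  then have dist: "3 \<le> d_SR L N C"
    by (simp add: numeral_eq_enat)
  \<comment> \<open>The syndrome is onto: every nonzero value already comes from a word with a
    single nonzero block.\<close>
  have "\<exists>v\<in>carrier_vec ?n. s v = w" if "w \<in> ?W" for w
  proof (cases "w = 0")
    case True
    then show ?thesis
      using s_0 by (intro bexI[of _ "0\<^sub>v ?n"]) auto
  next
    case False
    then have "w \<in> (\<lambda>(i, x). f i x) ` ({..<L} \<times> (carrier_vec N - {0\<^sub>v N}))"
      using that bij_f by (simp add: bij_betw_def)
    then obtain i x where ix: "i < L" "x \<in> carrier_vec N" "w = f i x"
      by auto
    have "s (single_block L N i x) = (\<Sum>k<L. if k = i then f i x else 0)"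
      unfolding s_def using ix by (intro sum.cong) (auto simp: block_single_block f_0)
    then show ?thesis
      using ix by (intro bexI[of _ "single_block L N i x"]) auto
  qed
  \<comment> \<open>These words represent the cosets of \<open>C\<close>; splitting every word into
    a codeword and a representative counts the cosets.\<close>
  then obtain u where u: "\<And>w. w \<in> ?W \<Longrightarrow> u w \<in> carrier_vec ?n \<and> s (u w) = w"
    by metis
  have "bij_betw (\<lambda>(c, w). c + u w) (C \<times> ?W) (carrier_vec ?n)"
  proof (rule bij_betw_byWitness[where f' = "\<lambda>v. (v - u (s v), s v)"])
    show "\<forall>a\<in>C \<times> ?W. (\<lambda>v. (v - u (s v), s v)) (case a of (c, w) \<Rightarrow> c + u w) = a"
    proof
      fix a assume "a \<in> C \<times> ?W"
      then obtain c w where a: "a = (c, w)" and "c \<in> C" "w \<in> ?W"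
        by auto
      then have c: "c \<in> carrier_vec ?n" "s c = 0" and w: "u w \<in> carrier_vec ?n" "s (u w) = w"
        using u by (auto simp: C_def)
      then have "s (c + u w) = w"
        by (simp add: s_add)
      moreover have "c + u w - u w = c"
        using c w by (intro eq_vecI) auto
      ultimately show "(\<lambda>v. (v - u (s v), s v)) (case a of (c, w) \<Rightarrow> c + u w) = a"
        by (simp add: a)
    qed
    show "\<forall>v\<in>carrier_vec ?n. (case (v - u (s v), s v) of (c, w) \<Rightarrow> c + u w) = v"
    proof
      fix v :: "'a vec" assume "v \<in> carrier_vec ?n"
      then show "(case (v - u (s v), s v) of (c, w) \<Rightarrow> c + u w) = v"
        using u[OF s_W[of v]] by (auto intro!: eq_vecI)
    qed
    show "(\<lambda>(c, w). c + u w) ` (C \<times> ?W) \<subseteq> carrier_vec ?n"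
      using u by (auto simp: C_def)
    show "(\<lambda>v. (v - u (s v), s v)) ` carrier_vec ?n \<subseteq> C \<times> ?W"
    proof (rule image_subsetI)
      fix v :: "'a vec" assume v: "v \<in> carrier_vec ?n"
      have uv: "u (s v) \<in> carrier_vec ?n" "s (u (s v)) = s v"
        using u[OF s_W[of v]] by auto
      have "v - u (s v) = v + (-1) \<cdot>\<^sub>v u (s v)"
        using v uv by (intro eq_vecI) auto
      then have "s (v - u (s v)) = 0"
        using v uv by (simp add: s_add s_smult)
      then show "(v - u (s v), s v) \<in> C \<times> ?W"
        using v uv s_W by (simp add: C_def)
    qed
  qed
  from bij_betw_same_card[OF this] have "card C * CARD('a) ^ (h * N) = CARD('a) ^ ?n"
    using assms by (simp add: card_cartesian_product card_power_fixed card_carrier_vec)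
  also have "\<dots> = card C * CARD('a) ^ redundancy ?n C"
    by (rule card_linear_code_redundancy(1)[OF lin, symmetric])
  finally have "CARD('a) ^ (h * N) = CARD('a) ^ redundancy ?n C"
    using card_linear_code[OF lin] finite_UNIV_card_ge_0[where ?'a = 'a] by simp
  then have red: "redundancy ?n C = h * N"
    using two_le_CARD[where 'a = 'a] by (simp add: power_inject_exp)
  have "finite ?W"
    using card_power_fixed[of "h * N", where 'a = 'a] two_le_CARD[where 'a = 'a] assms
    by (intro card_ge_0_finite) simp
  \<comment> \<open>The spread partitions the nonzero field elements, which determines the number of
    its members.\<close>
  with bij_betw_same_card[OF bij_f] have "L * (CARD('a) ^ N - 1) = CARD('a) ^ (h * N) - 1"
    using assms
    by (simp add: card_cartesian_product card_Diff_singleton finite_carrier_vec card_carrier_vec card_power_fixed)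
  with lin dist red show thesis
    by (rule that)
qed

text \<open>The spread code has the same redundancy, so properness rules out \<open>l < L\<close>;
  sphere packing gives the opposite inequality.\<close>

lemma proper_SR_Hamming_length:
  fixes C :: "'a::{field,finite} vec set"
  assumes "proper_SR_Hamming l N C" "redundancy (l * N) C = h * N" "0 < N" "0 < h"
  shows "l * (CARD('a) ^ N - 1) = CARD('a) ^ (h * N) - 1"
proof -
  obtain L and C' :: "'a vec set" where C': "linear_code (L * N) C'" "3 \<le> d_SR L N C'"
    "redundancy (L * N) C' = h * N" "L * (CARD('a) ^ N - 1) = CARD('a) ^ (h * N) - 1"
    using Hamming_code_exists[OF assms(3,4)] .
  have "\<not> l < L"
    using assms(1,2) C' unfolding proper_SR_Hamming_def by metis
  then have "L * (CARD('a) ^ N - 1) \<le> l * (CARD('a) ^ N - 1)"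
    by simp
  moreover have "1 + l * (CARD('a) ^ N - 1) \<le> CARD('a) ^ (h * N)"
    using assms(1,2) sphere_packing[of l N C] unfolding proper_SR_Hamming_def by simp
  ultimately show ?thesis
    using C'(4) by linarith
qed

section \<open>The global code\<close>

lemma code_dim_carrier_vec:
  "linear_code n (carrier_vec n :: 'a::{field,finite} vec set)"
  "code_dim n (carrier_vec n :: 'a::{field,finite} vec set) = n"
proof -
  show lin: "linear_code n (carrier_vec n :: 'a vec set)"
    by (auto simp: linear_code_iff)
  show "code_dim n (carrier_vec n :: 'a vec set) = n"
    using card_linear_code[OF lin] two_le_CARD[where 'a = 'a]
    by (simp add: card_carrier_vec power_inject_exp)
qed

lemma linear_code_image:
  fixes A :: "'a::field mat"
  assumes "linear_code n C" "A \<in> carrier_mat m n"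
  shows "linear_code m ((*\<^sub>v) A ` C)"
  unfolding linear_code_iff
proof (intro conjI ballI allI)
  have car: "x \<in> carrier_vec n" if "x \<in> C" for x
    using linear_codeD(1)[OF assms(1)] that by blast
  show "(*\<^sub>v) A ` C \<subseteq> carrier_vec m"
    using car assms(2) by auto
  have "A *\<^sub>v 0\<^sub>v n = 0\<^sub>v m"
    using assms(2) by (intro eq_vecI) auto
  then show "0\<^sub>v m \<in> (*\<^sub>v) A ` C"
    using linear_codeD(2)[OF assms(1)] by (metis image_eqI)
  show "v + w \<in> (*\<^sub>v) A ` C" if vw: "v \<in> (*\<^sub>v) A ` C" "w \<in> (*\<^sub>v) A ` C" for v w
  proof -
    obtain x y where xy: "x \<in> C" "y \<in> C" "v = A *\<^sub>v x" "w = A *\<^sub>v y"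
      using vw by blast
    then have "v + w = A *\<^sub>v (x + y)"
      using mult_add_distrib_mat_vec[OF assms(2) car car] by simp
    then show ?thesis
      using linear_codeD(3)[OF assms(1) xy(1,2)] by blast
  qed
  show "a \<cdot>\<^sub>v v \<in> (*\<^sub>v) A ` C" if v: "v \<in> (*\<^sub>v) A ` C" for a v
  proof -
    obtain x where x: "x \<in> C" "v = A *\<^sub>v x"
      using v by blast
    then have "a \<cdot>\<^sub>v v = A *\<^sub>v (a \<cdot>\<^sub>v x)"
      using mult_mat_vec[OF assms(2) car] by simp
    then show ?thesis
      using linear_codeD(4)[OF assms(1) x(1)] by blast
  qed
qed

text \<open>An injective map preserves cardinality, and over a finite field the cardinality of a
  code determines its dimension.\<close>

lemma code_dim_image:
  fixes A :: "'a::{field,finite} mat"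
  assumes "linear_code n C" "A \<in> carrier_mat m n" "inj_on ((*\<^sub>v) A) C"
  shows "code_dim m ((*\<^sub>v) A ` C) = code_dim n C"
proof -
  have "CARD('a) ^ code_dim m ((*\<^sub>v) A ` C) = CARD('a) ^ code_dim n C"
    using card_image[OF assms(3)] card_linear_code[OF assms(1)]
      card_linear_code[OF linear_code_image[OF assms(1,2)]] by simp
  then show ?thesis
    using two_le_CARD[where 'a = 'a] by (simp add: power_inject_exp)
qed

section \<open>Block-diagonal generator matrices\<close>

lemma diag_block_mat_replicate_carrier:
  assumes "G \<in> carrier_mat N m"
  shows "diag_block_mat (replicate l G) \<in> carrier_mat (l * N) (l * m)"
  using assms by (intro carrier_matI) (simp_all add: dim_diag_block_mat sum_list_replicate)

text \<open>Induction peels off the first block. For an entry beyond the first block row and column,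
  this keeps both remainders and lowers both quotients by one.\<close>

lemma index_diag_block_mat_replicate:
  assumes "G \<in> carrier_mat N m" "a < l * N" "b < l * m"
  shows "diag_block_mat (replicate l G) $$ (a, b)
    = (if a div N = b div m then G $$ (a mod N, b mod m) else 0)"
  using assms(2,3)
proof (induction l arbitrary: a b)
  case (Suc l)
  have "0 < N" "0 < m"
    using Suc.prems by (auto intro: Nat.gr0I)
  have D: "diag_block_mat (replicate l G) \<in> carrier_mat (l * N) (l * m)"
    by (rule diag_block_mat_replicate_carrier[OF assms(1)])
  let ?D = "diag_block_mat (replicate l G)"
  have "diag_block_mat (replicate (Suc l) G) $$ (a, b)
      = (if a < N then if b < m then G $$ (a, b) else 0
         else if b < m then 0 else ?D $$ (a - N, b - m))"
    using assms(1) D Suc.prems by (auto simp: Let_def)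
  also have "\<dots> = (if a div N = b div m then G $$ (a mod N, b mod m) else 0)"
  proof (cases "a < N \<or> b < m")
    case True
    then show ?thesis
      using \<open>0 < N\<close> \<open>0 < m\<close> by (auto simp: div_eq_0_iff not_less)
  next
    case False
    then have "a - N < l * N" "b - m < l * m"
      using Suc.prems by auto
    with Suc.IH[OF this] False show ?thesis
      using \<open>0 < N\<close> \<open>0 < m\<close> by (simp add: le_div_geq le_mod_geq not_less)
  qed
  finally show ?case .
qed simp

text \<open>Grouping the sum over the rows by blocks leaves only the rows of block \<open>i\<close>,
  since all other entries in these columns vanish.\<close>

lemma block_diag_block_mat_mult:
  fixes G :: "'a::field mat"
  assumes G: "G \<in> carrier_mat N m" and c: "c \<in> carrier_vec (l * N)" and "i < l"
  shows "block m ((diag_block_mat (replicate l G))\<^sup>T *\<^sub>v c) i = G\<^sup>T *\<^sub>v block N c i"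
proof (rule eq_vecI)
  let ?D = "diag_block_mat (replicate l G)"
  have D: "?D \<in> carrier_mat (l * N) (l * m)"
    by (rule diag_block_mat_replicate_carrier[OF G])
  fix j assume "j < dim_vec (G\<^sup>T *\<^sub>v block N c i)"
  then have j: "j < m"
    using G by simp
  let ?b = "i * m + j"
  have b: "?b < l * m"
    using block_index_less[OF \<open>i < l\<close> j] .
  have "(?D\<^sup>T *\<^sub>v c) $ ?b = (\<Sum>a<l * N. ?D $$ (a, ?b) * c $ a)"
    using D c b by (simp add: scalar_prod_def atLeast0LessThan)
  also have "\<dots> = (\<Sum>k<l. \<Sum>a\<in>{k * N..<k * N + N}. ?D $$ (a, ?b) * c $ a)"
    by (rule sum.nat_group[symmetric])
  also have "\<dots> = (\<Sum>k<l. \<Sum>t<N. ?D $$ (k * N + t, ?b) * c $ (k * N + t))"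
  proof (rule sum.cong[OF refl])
    fix k
    show "(\<Sum>a\<in>{k * N..<k * N + N}. ?D $$ (a, ?b) * c $ a)
        = (\<Sum>t<N. ?D $$ (k * N + t, ?b) * c $ (k * N + t))"
      using sum.shift_bounds_nat_ivl[of "\<lambda>a. ?D $$ (a, ?b) * c $ a" 0 "k * N" N]
      by (simp add: add.commute atLeast0LessThan)
  qed
  also have "\<dots> = (\<Sum>k<l. if k = i then \<Sum>t<N. G $$ (t, j) * c $ (i * N + t) else 0)"
  proof (rule sum.cong[OF refl])
    fix k assume "k \<in> {..<l}"
    then have "?D $$ (k * N + t, ?b) = (if k = i then G $$ (t, j) else 0)" if "t < N" for t
      using index_diag_block_mat_replicate[OF G block_index_less[of k l t N] b] j that by simp
    then show "(\<Sum>t<N. ?D $$ (k * N + t, ?b) * c $ (k * N + t))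
        = (if k = i then \<Sum>t<N. G $$ (t, j) * c $ (i * N + t) else 0)"
      by simp
  qed
  also have "\<dots> = (\<Sum>t<N. G $$ (t, j) * c $ (i * N + t))"
    using \<open>i < l\<close> by simp
  also have "\<dots> = (G\<^sup>T *\<^sub>v block N c i) $ j"
    using G j by (simp add: scalar_prod_def block_def atLeast0LessThan)
  finally show "block m (?D\<^sup>T *\<^sub>v c) i $ j = (G\<^sup>T *\<^sub>v block N c i) $ j"
    using j by (simp add: block_def)
qed (use G in \<open>simp add: block_def\<close>)

section \<open>The single parity check local code\<close>

lemma local_generator_carrier: "local_generator N \<in> carrier_mat N (N + 1)"
  by (simp add: local_generator_def)

lemma local_generator_encode:
  fixes x :: "'a::field vec"
  assumes "x \<in> carrier_vec N"
  shows "(local_generator N)\<^sup>T *\<^sub>v x = vec (N + 1) (\<lambda>j. if j < N then x $ j else \<Sum>t<N. x $ t)"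
proof (rule eq_vecI)
  fix j assume "j < dim_vec (vec (N + 1) (\<lambda>j. if j < N then x $ j else \<Sum>t<N. x $ t))"
  then have j: "j < N + 1"
    by simp
  then have "((local_generator N)\<^sup>T *\<^sub>v x) $ j = (\<Sum>t<N. (if j = t \<or> j = N then 1 else 0) * x $ t)"
    using assms by (simp add: scalar_prod_def local_generator_def atLeast0LessThan)
  also have "\<dots> = (if j < N then x $ j else \<Sum>t<N. x $ t)"
  proof (cases "j = N")
    case False
    then have "(\<Sum>t<N. (if j = t \<or> j = N then 1 else 0) * x $ t) = (\<Sum>t<N. if j = t then x $ t else 0)"
      by (intro sum.cong) auto
    then show ?thesis
      using j False by simp
  qed simp
  finally show "((local_generator N)\<^sup>T *\<^sub>v x) $ j
      = vec (N + 1) (\<lambda>j. if j < N then x $ j else \<Sum>t<N. x $ t) $ j"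
    using j by simp
qed (simp add: local_generator_def)

text \<open>Encoding is injective because the first \<open>N\<close> symbols repeat the message, so
  the row space has dimension \<open>N\<close> in length \<open>N + 1\<close>.\<close>

lemma local_code:
  fixes C :: "'a::{field,finite} vec set"
  assumes "C = vec_space.row_space (N + 1) (local_generator N)"
  shows "linear_code (N + 1) C" "redundancy (N + 1) C = 1"
proof -
  interpret vec_space "TYPE('a)" "N + 1" .
  let ?G = "local_generator N :: 'a mat"
  have G: "?G\<^sup>T \<in> carrier_mat (N + 1) N"
    by (simp only: transpose_carrier_mat local_generator_carrier)
  have C: "C = (*\<^sub>v) ?G\<^sup>T ` carrier_vec N"
    unfolding assms row_space_eq[OF local_generator_carrier]
    using local_generator_carrier[of N, where 'a = 'a] by auto
  have "inj_on ((*\<^sub>v) ?G\<^sup>T) (carrier_vec N)"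
  proof (rule inj_onI)
    fix x y :: "'a vec"
    assume xy: "x \<in> carrier_vec N" "y \<in> carrier_vec N" and eq: "?G\<^sup>T *\<^sub>v x = ?G\<^sup>T *\<^sub>v y"
    show "x = y"
    proof (rule eq_vecI)
      fix t assume "t < dim_vec y"
      then show "x $ t = y $ t"
        using arg_cong[OF eq, of "\<lambda>v. v $ t"] xy by (simp add: local_generator_encode)
    qed (use xy in simp)
  qed
  then show "linear_code (N + 1) C" "redundancy (N + 1) C = 1"
    using linear_code_image[OF code_dim_carrier_vec(1) G] code_dim_image[OF code_dim_carrier_vec(1) G]
    by (simp_all add: C redundancy_def code_dim_carrier_vec(2))
qed

section \<open>Global encoding, local repair and erasure correction\<close>

definition encode :: "nat \<Rightarrow> nat \<Rightarrow> 'a::field vec \<Rightarrow> 'a vec" where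
  "encode l N c = (diag_block_mat (replicate l (local_generator N)))\<^sup>T *\<^sub>v c"

lemma encode_index:
  assumes "c \<in> carrier_vec (l * N)" "i < l" "j < N + 1"
  shows "encode l N c $ (i * (N + 1) + j)
    = (if j < N then c $ (i * N + j) else \<Sum>t<N. c $ (i * N + t))"
proof -
  have "encode l N c $ (i * (N + 1) + j) = block (N + 1) (encode l N c) i $ j"
    using assms(3) by (simp add: block_def)
  also have "\<dots> = (if j < N then c $ (i * N + j) else \<Sum>t<N. c $ (i * N + t))"
    unfolding encode_def block_diag_block_mat_mult[OF local_generator_carrier assms(1,2)]
      local_generator_encode[OF block_carrier]
    using assms(3) by (simp add: block_def)
  finally show ?thesis .
qed

text \<open>The first \<open>N\<close> symbols of a local group copy the block, so a difference is
  already visible among them.\<close>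

lemma block_neq_imp_encode_neq:
  assumes "c \<in> carrier_vec (l * N)" "d \<in> carrier_vec (l * N)" "i < l" "block N c i \<noteq> block N d i"
  obtains j where "j \<in> local_group N i" "encode l N c $ j \<noteq> encode l N d $ j"
proof -
  obtain t where t: "t < N" "c $ (i * N + t) \<noteq> d $ (i * N + t)"
    using assms(4) by (auto simp: block_def vec_eq_iff)
  show thesis
  proof (rule that)
    show "i * (N + 1) + t \<in> local_group N i"
      using t by (simp add: local_group_def)
    show "encode l N c $ (i * (N + 1) + t) \<noteq> encode l N d $ (i * (N + 1) + t)"
      using t encode_index[OF assms(1,3), of t] encode_index[OF assms(2,3), of t] by simp
  qed
qed

lemma inj_on_encode: "inj_on (encode l N) (carrier_vec (l * N))"
proof (rule inj_onI)
  fix c d :: "'a vec"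
  assume cd: "c \<in> carrier_vec (l * N)" "d \<in> carrier_vec (l * N)" "encode l N c = encode l N d"
  then show "c = d"
    by (intro blocks_eqI[OF cd(1,2)]) (metis block_neq_imp_encode_neq)
qed

lemma encode_parity:
  assumes "c \<in> carrier_vec (l * N)" "i < l"
  shows "encode l N c $ (i * (N + 1) + N)
    = (\<Sum>t\<in>{i * (N + 1)..<i * (N + 1) + N}. encode l N c $ t)"
proof -
  have "(\<Sum>t\<in>{i * (N + 1)..<i * (N + 1) + N}. encode l N c $ t)
      = (\<Sum>t<N. encode l N c $ (i * (N + 1) + t))"
    using sum.shift_bounds_nat_ivl[of "\<lambda>t. encode l N c $ t" 0 "i * (N + 1)" N]
    by (simp add: add.commute atLeast0LessThan)
  also have "\<dots> = (\<Sum>t<N. c $ (i * N + t))"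
  proof (rule sum.cong[OF refl])
    fix t assume "t \<in> {..<N}"
    then show "encode l N c $ (i * (N + 1) + t) = c $ (i * N + t)"
      using encode_index[OF assms, of t] by simp
  qed
  also have "\<dots> = encode l N c $ (i * (N + 1) + N)"
    using encode_index[OF assms, of N] by simp
  finally show ?thesis ..
qed

text \<open>The last symbol of a group is the sum of the others. Solving this relation for another
  symbol gives coefficient 1 at the last position and -1 elsewhere. The coefficients are chosen
  before the codeword; in characteristic 2 they are all 1, a plain XOR.\<close>

lemma encode_recover:
  assumes "i < l" "j \<in> local_group N i"
  obtains a :: "nat \<Rightarrow> 'a::field" where "\<forall>t\<in>local_group N i - {j}. a t = 1 \<or> a t = -1"
    "\<forall>c\<in>carrier_vec (l * N).
       encode l N c $ j = (\<Sum>t\<in>local_group N i - {j}. a t * encode l N c $ t)"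
proof -
  define b where "b = i * (N + 1)"
  have group: "local_group N i = insert (b + N) {b..<b + N}"
    by (auto simp: local_group_def b_def)
  have parity: "encode l N c $ (b + N) = (\<Sum>t\<in>{b..<b + N}. encode l N c $ t)"
    if "c \<in> carrier_vec (l * N)" for c :: "'a vec"
    unfolding b_def by (rule encode_parity[OF that assms(1)])
  show thesis
  proof (cases "j = b + N")
    case True
    then have "local_group N i - {j} = {b..<b + N}"
      by (auto simp: group)
    then show thesis
      using that[of "\<lambda>_. 1"] parity True by simp
  next
    case False
    then have j: "j \<in> {b..<b + N}"
      using assms(2) by (auto simp: group)
    define a :: "nat \<Rightarrow> 'a" where "a t = (if t = b + N then 1 else -1)" for t
    have diff: "local_group N i - {j} = insert (b + N) ({b..<b + N} - {j})"
      using False by (auto simp: group)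
    show thesis
    proof (rule that[of a])
      show "\<forall>t\<in>local_group N i - {j}. a t = 1 \<or> a t = -1"
        by (simp add: a_def)
    next
      show "\<forall>c\<in>carrier_vec (l * N). encode l N c $ j
          = (\<Sum>t\<in>local_group N i - {j}. a t * encode l N c $ t)"
      proof
        fix c :: "'a vec" assume c: "c \<in> carrier_vec (l * N)"
        let ?v = "\<lambda>t. encode l N c $ t"
        have "(\<Sum>t\<in>{b..<b + N} - {j}. a t * ?v t) = (\<Sum>t\<in>{b..<b + N} - {j}. - ?v t)"
          by (intro sum.cong) (auto simp: a_def)
        then have "(\<Sum>t\<in>local_group N i - {j}. a t * ?v t) = ?v (b + N) - (\<Sum>t\<in>{b..<b + N} - {j}. ?v t)"
          unfolding diff by (simp add: a_def sum_negf)
        also have "\<dots> = ?v j"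
          using parity[OF c] sum.remove[OF _ j, of ?v] by simp
        finally show "?v j = (\<Sum>t\<in>local_group N i - {j}. a t * ?v t)" ..
      qed
    qed
  qed
qed

text \<open>A differing block needs two erased positions in its local group; \<open>E1\<close>
  supplies at most one, so \<open>E2\<close> must supply another. Hence the outer words differ in at
  most two blocks and coincide.\<close>

lemma corrects_encode:
  fixes C :: "'a::field vec set"
  assumes C: "linear_code (l * N) C" "3 \<le> d_SR l N C"
    and E1: "\<And>i. i < l \<Longrightarrow> card (E1 \<inter> local_group N i) \<le> 1"
    and E2: "finite E2" "card E2 \<le> 2"
  shows "corrects (l * (N + 1)) (encode l N ` C) (E1 \<union> E2)"
  unfolding corrects_def
proof (intro ballI impI)
  fix v w assume vw: "v \<in> encode l N ` C" "w \<in> encode l N ` C"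
    and agree: "\<forall>t\<in>{..<l * (N + 1)} - (E1 \<union> E2). v $ t = w $ t"
  obtain c d where cd: "c \<in> C" "d \<in> C" and v: "v = encode l N c" and w: "w = encode l N d"
    using vw by blast
  have car: "c \<in> carrier_vec (l * N)" "d \<in> carrier_vec (l * N)"
    using linear_codeD(1)[OF C(1)] cd by blast+
  \<comment> \<open>Each differing block is charged to an extra erasure in its own local group, so
    there are at most \<open>card E2\<close> of them.\<close>
  have "{i. i < l \<and> block N c i \<noteq> block N d i} \<subseteq> (\<lambda>t. t div (N + 1)) ` E2"
  proof clarify
    fix i assume i: "i < l" "block N c i \<noteq> block N d i"
    have erased: "t \<in> E1 \<union> E2" if "t \<in> local_group N i" "v $ t \<noteq> w $ t" for t
    proof -
      \<comment> \<open>The whole local group lies below \<open>l * (N + 1)\<close>, so the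
        agreement assumption covers each of its positions outside the erasures.\<close>
      have "(i + 1) * (N + 1) \<le> l * (N + 1)"
        using i(1) by (intro mult_le_mono1) simp
      then show ?thesis
        using that agree by (auto simp: local_group_def simp del: mult_Suc_right)
    qed
    have group_div: "t div (N + 1) = i" if "t \<in> local_group N i" for t
      using that by (intro div_nat_eqI) (simp_all add: local_group_def mult.commute)
    obtain j where j: "j \<in> local_group N i" "v $ j \<noteq> w $ j"
      using block_neq_imp_encode_neq[OF car i] unfolding v w .
    obtain a :: "nat \<Rightarrow> 'a" where "\<forall>t\<in>local_group N i - {j}. a t = 1 \<or> a t = -1"
      and recover: "\<forall>c\<in>carrier_vec (l * N).
        encode l N c $ j = (\<Sum>t\<in>local_group N i - {j}. a t * encode l N c $ t)"
      using encode_recover[OF i(1) j(1)] .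
    \<comment> \<open>If the words agreed on the rest of the group, recovery would make them agree
      at \<open>j\<close> as well; this yields a second differing position.\<close>
    have "(\<Sum>t\<in>local_group N i - {j}. a t * v $ t) \<noteq> (\<Sum>t\<in>local_group N i - {j}. a t * w $ t)"
      using j(2) bspec[OF recover car(1)] bspec[OF recover car(2)] by (simp add: v w)
    then have "\<exists>k\<in>local_group N i - {j}. v $ k \<noteq> w $ k"
      by (rule contrapos_np) (auto intro: sum.cong)
    then obtain k where k: "k \<in> local_group N i - {j}" "v $ k \<noteq> w $ k"
      by blast
    have "j \<in> E2 \<or> k \<in> E2"
    proof (rule ccontr)
      assume "\<not> (j \<in> E2 \<or> k \<in> E2)"
      then have "{j, k} \<subseteq> E1 \<inter> local_group N i"
        using erased j k by auto
      then have "card {j, k} \<le> card (E1 \<inter> local_group N i)"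
        by (intro card_mono) (auto simp: local_group_def)
      then show False
        using E1[OF i(1)] k(1) by auto
    qed
    moreover have "i = j div (N + 1)" "i = k div (N + 1)"
      using group_div j(1) k(1) by (metis, metis DiffD1)
    ultimately show "i \<in> (\<lambda>t. t div (N + 1)) ` E2"
      by (elim disjE) (rule image_eqI, assumption+)+
  qed
  then have "c = d"
    using d_SR_3_eqI[OF C cd, of "(\<lambda>t. t div (N + 1)) ` E2"] E2 card_image_le[OF E2(1)]
    by (meson finite_imageI le_trans)
  then show "v = w"
    by (simp add: v w)
qed

theorem theorem9:
  fixes q l N r h n M :: nat
    and A :: "nat \<Rightarrow> 'a::{field, finite} mat"
    and C_out C_glob :: "'a vec set"
    and C_loc :: "nat \<Rightarrow> 'a vec set"
  assumes "q = CARD('a)"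
    and "0 < N"
    and "n = l * N"
    and "M = l * (N + 1)"
    and "N \<le> r"
    and "r = h * N"
    and "proper_SR_Hamming l N C_out"
    and "r = redundancy n C_out"
    and "\<forall>i<l. A i = local_generator N"
    and "\<forall>i<l. C_loc i = vec_space.row_space (N + 1) (A i)"
    and "C_glob = code_times_mat C_out (diag_block_mat (map A [0..<l]))"
  shows "linear_code M C_glob
    \<and> has_locality l N C_glob
    \<and> real l = (real q ^ r - 1) / (real q ^ N - 1)
    \<and> real M = (real N + 1) * ((real q ^ r - 1) / (real q ^ N - 1))
    \<and> real (code_dim M C_glob) = real N * ((real q ^ r - 1) / (real q ^ N - 1)) - real r
    \<and> real (code_dim M C_glob) = real N * ((real q ^ r - 1) / (real q ^ N - 1) - real h)
    \<and> (\<forall>i<l. linear_code (N + 1) (C_loc i) \<and> redundancy (N + 1) (C_loc i) = 1)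
    \<and> redundancy n C_out = r
    \<and> (\<forall>i<l. \<forall>j\<in>local_group N i. \<exists>a :: nat \<Rightarrow> 'a.
         (\<forall>t\<in>local_group N i - {j}. a t = 1 \<or> a t = -1) \<and>
         (\<forall>c\<in>C_glob. c $ j = (\<Sum>t\<in>local_group N i - {j}. a t * c $ t)))
    \<and> (\<forall>E1 E2. E1 \<subseteq> {..<M} \<longrightarrow> E2 \<subseteq> {..<M} \<longrightarrow>
         (\<forall>i<l. card (E1 \<inter> local_group N i) \<le> 1) \<longrightarrow> card E2 \<le> 2 \<longrightarrow>
         corrects M C_glob (E1 \<union> E2))"
proof -
  let ?q = "real q"
  note lN = \<open>n = l * N\<close>
  have proper: "linear_code (l * N) C_out" "3 \<le> d_SR l N C_out"
    using assms(7) by (simp_all add: proper_SR_Hamming_def)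
  have red: "redundancy (l * N) C_out = h * N"
    using assms(3,6,8) by simp
  \<comment> \<open>Otherwise \<open>r = 0\<close>, against \<open>N \<le> r\<close> with positive
    \<open>N\<close>.\<close>
  have "0 < h"
    using assms(2,5,6) by (cases h) auto
  have "2 \<le> q"
    using two_le_CARD[where 'a = 'a] assms(1) by simp
  \<comment> \<open>\<open>A\<close> is known only on indices below \<open>l\<close>, exactly those
    listed by \<open>[0..<l]\<close>.\<close>
  have "map A [0..<l] = map (\<lambda>_. local_generator N) [0..<l]"
    using assms(9) by (intro map_cong) auto
  then have A: "map A [0..<l] = replicate l (local_generator N)"
    by (simp add: map_replicate_const)
  have glob: "C_glob = encode l N ` C_out"
    unfolding assms(11) code_times_mat_def encode_def A by blast
  have D: "(diag_block_mat (replicate l (local_generator N)))\<^sup>T \<in> carrier_mat M (l * N)"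
    unfolding assms(4) transpose_carrier_mat
    by (rule diag_block_mat_replicate_carrier[OF local_generator_carrier])
  have out_carrier: "C_out \<subseteq> carrier_vec (l * N)"
    by (rule linear_codeD(1)[OF proper(1)])
  have lin: "linear_code M C_glob"
    using linear_code_image[OF proper(1) D] by (simp add: glob encode_def[abs_def])
  have "inj_on (encode l N) C_out"
    using inj_on_encode out_carrier by (rule inj_on_subset)
  then have dim: "code_dim M C_glob = code_dim n C_out"
    using code_dim_image[OF proper(1) D] by (simp add: glob encode_def[abs_def] lN)
  have recover: "\<exists>a :: nat \<Rightarrow> 'a. (\<forall>t\<in>local_group N i - {j}. a t = 1 \<or> a t = -1) \<and>
      (\<forall>c\<in>C_glob. c $ j = (\<Sum>t\<in>local_group N i - {j}. a t * c $ t))"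
    if ij: "i < l" "j \<in> local_group N i" for i j
  proof -
    obtain a :: "nat \<Rightarrow> 'a" where "\<forall>t\<in>local_group N i - {j}. a t = 1 \<or> a t = -1"
      "\<forall>c\<in>carrier_vec (l * N).
        encode l N c $ j = (\<Sum>t\<in>local_group N i - {j}. a t * encode l N c $ t)"
      using encode_recover[OF ij] .
    then show ?thesis
      using out_carrier unfolding glob by (intro exI[of _ a]) auto
  qed
  have locality: "has_locality l N C_glob"
    unfolding has_locality_def recoverable_from_def
  proof (intro allI impI ballI)
    fix i j assume "i < l" "j \<in> local_group N i"
    from recover[OF this] obtain a :: "nat \<Rightarrow> 'a"
      where a: "\<forall>c\<in>C_glob. c $ j = (\<Sum>t\<in>local_group N i - {j}. a t * c $ t)"
      by blast
    \<comment> \<open>The repair function is the same signed sum; it reads only positions kept by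
      \<open>restrict\<close>.\<close>
    show "\<exists>f. \<forall>c\<in>C_glob. c $ j = f (restrict (($) c) (local_group N i - {j}))"
      by (rule exI[of _ "\<lambda>g. \<Sum>t\<in>local_group N i - {j}. a t * g t"]) (simp add: a)
  qed
  have "l * (q ^ N - 1) = q ^ r - 1"
    using proper_SR_Hamming_length[OF assms(7) red assms(2) \<open>0 < h\<close>] assms(1,6) by simp
  \<comment> \<open>The identity over the naturals is moved to the reals, where both truncated
    subtractions are exact and q^N - 1 can be divided out.\<close>
  then have "real l * real (q ^ N - 1) = real (q ^ r - 1)"
    by (metis of_nat_mult)
  moreover have "real (q ^ m - 1) = ?q ^ m - 1" for m
    using \<open>2 \<le> q\<close> by (simp add: of_nat_diff)
  ultimately have "real l * (?q ^ N - 1) = ?q ^ r - 1"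
    by simp
  moreover have "1 < ?q ^ N"
    using \<open>2 \<le> q\<close> assms(2) by (intro one_less_power) auto
  ultimately have len: "real l = (?q ^ r - 1) / (?q ^ N - 1)"
    by (simp add: eq_divide_eq)
  \<comment> \<open>The dimension is at most \<open>n\<close>, so the truncated difference defining
    the redundancy becomes a sum.\<close>
  have "code_dim n C_out + r = n"
    using card_linear_code_redundancy(2)[OF proper(1)] assms(8) by (simp add: redundancy_def lN)
  then have "real (code_dim n C_out) = real (n - r)" "r \<le> n"
    by auto
  then have k: "real (code_dim M C_glob) = real N * ((?q ^ r - 1) / (?q ^ N - 1)) - real r"
    unfolding dim len[symmetric] by (simp add: of_nat_diff lN)
  have k': "real (code_dim M C_glob) = real N * ((?q ^ r - 1) / (?q ^ N - 1) - real h)"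
    using k assms(6) by (simp add: right_diff_distrib mult.commute)
  have len_M: "real M = (real N + 1) * ((?q ^ r - 1) / (?q ^ N - 1))"
    unfolding len[symmetric] by (simp add: assms(4) algebra_simps)
  have loc: "\<forall>i<l. linear_code (N + 1) (C_loc i) \<and> redundancy (N + 1) (C_loc i) = 1"
    using local_code assms(9,10) by metis
  have "corrects M C_glob (E1 \<union> E2)"
    if "E2 \<subseteq> {..<M}" "\<forall>i<l. card (E1 \<inter> local_group N i) \<le> 1" "card E2 \<le> 2" for E1 E2
    unfolding glob assms(4)
    using that finite_subset[OF that(1)] by (intro corrects_encode[OF proper]) auto
  then have corr: "\<forall>E1 E2. E1 \<subseteq> {..<M} \<longrightarrow> E2 \<subseteq> {..<M} \<longrightarrow>
      (\<forall>i<l. card (E1 \<inter> local_group N i) \<le> 1) \<longrightarrow> card E2 \<le> 2 \<longrightarrow> corrects M C_glob (E1 \<union> E2)"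
    by simp
  have rec: "\<forall>i<l. \<forall>j\<in>local_group N i. \<exists>a :: nat \<Rightarrow> 'a.
      (\<forall>t\<in>local_group N i - {j}. a t = 1 \<or> a t = -1) \<and>
      (\<forall>c\<in>C_glob. c $ j = (\<Sum>t\<in>local_group N i - {j}. a t * c $ t))"
    using recover by (intro allI impI ballI)
  show ?thesis
    by (intro conjI lin locality len len_M k k' loc assms(8)[symmetric] rec corr)
qed

end
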